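(* Let $A\subset\mathbb{E}^n$ be an open subset with boundary $\partial A=\overline{A}\setminus A$, and suppose that either $A$ is bounded or $\partial A$ is unbounded. Then the function $\delta_A$ on $A\times A$ defined by $$\delta_A(x,y)=\sup_{a\in\partial A}\log\frac{|x-a|}{|y-a|}$$ is a weak metric on $A$.
   Context: $\mathbb{E}^n$ is Euclidean $n$-space ($n\ge 1$) and $|x-y|$ is the Euclidean distance. A weak metric on a set $X$ is a function $\delta:X\times X\to[0,\infty)$ such that $\delta(x,x)=0$ for all $x\in X$ and $\delta(x,y)+\delta(y,z)\ge\delta(x,z)$ for all $x,y,z\in X$ (no symmetry or separation is required). In particular the values must be finite and nonnegative. *)

theory Defs
  imports "HOL-Analysis.Analysis"
begin

text \<open>
  Weak metrics and the supremum below are valued in \<^typ>\<open>ereal\<close>, so that finiteness of the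
  supremum is an explicit part of being a weak metric (codomain \<open>[0,\<infinity>)\<close>); in \<^typ>\<open>real\<close> the
  supremum of an unbounded or empty set would be an unspecified number.
\<close>

definition weak_metric_on :: "'a set \<Rightarrow> ('a \<Rightarrow> 'a \<Rightarrow> ereal) \<Rightarrow> bool" where
  "weak_metric_on X \<delta> \<longleftrightarrow>
     (\<forall>x\<in>X. \<forall>y\<in>X. 0 \<le> \<delta> x y \<and> \<delta> x y < \<infinity>) \<and>
     (\<forall>x\<in>X. \<delta> x x = 0) \<and>
     (\<forall>x\<in>X. \<forall>y\<in>X. \<forall>z\<in>X. \<delta> x y + \<delta> y z \<ge> \<delta> x z)"

text \<open>
  The boundary \<open>\<partial>A\<close> is the library's \<^const>\<open>frontier\<close>, i.e. closure minus interior, which for open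
  \<open>A\<close> is closure minus \<open>A\<close>. Only values at \<open>x, y \<in> A\<close> are meaningful: for open \<open>A\<close> both distances
  are then positive.
\<close>

lemma frontier_open_eq: "open A \<Longrightarrow> frontier A = closure A - A"
  by (simp add: frontier_def interior_open)

definition delta :: "(real ^ 'n) set \<Rightarrow> real ^ 'n \<Rightarrow> real ^ 'n \<Rightarrow> ereal" where
  "delta A x y = (SUP a\<in>frontier A. ereal (ln (dist x a / dist y a)))"

end

(* Finiteness and the triangle inequality are pointwise estimates on the logarithms. For
   nonnegativity, if A is bounded, the ray from y pointing away from x meets the boundary at a
   point at least as far from x as from y; if the boundary is unbounded, the ratio of distances
   tends to 1 as the boundary point goes to infinity. *)

theory Submission
  imports Defs
begin

lemma dist_frontier_pos:
  assumes "open A" "x \<in> A" "a \<in> frontier A"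
  shows "0 < dist x a"
  using assms by (auto simp: frontier_open_eq)

lemma ln_ratio_le_delta:
  "a \<in> frontier A \<Longrightarrow> ereal (ln (dist x a / dist y a)) \<le> delta A x y"
  unfolding delta_def by (rule SUP_upper)

text \<open>Over an empty frontier the supremum would be \<open>-\<infinity>\<close>, which would
  break \<open>delta A x x = 0\<close>. By connectedness, an empty frontier forces the nonempty set
  \<open>A\<close> to be the whole space, which is unbounded and has a bounded frontier.\<close>

lemma frontier_nonempty:
  fixes A :: "(real ^ 'n) set"
  assumes "bounded A \<or> \<not> bounded (frontier A)" "x \<in> A"
  shows "frontier A \<noteq> {}"
proof
  assume "frontier A = {}"
  then have "A = UNIV"
    using assms(2) by (auto simp: frontier_eq_empty)
  then show False
    using assms(1) by simp
qed

lemma delta_self: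
  fixes A :: "(real ^ 'n) set"
  assumes "open A" "x \<in> A" "frontier A \<noteq> {}"
  shows "delta A x x = 0"
proof -
  have "delta A x x = (SUP a\<in>frontier A. 0)"
    unfolding delta_def
  proof (rule SUP_cong)
    fix a assume "a \<in> frontier A"
    then have "0 < dist x a"
      using assms dist_frontier_pos by blast
    then show "ereal (ln (dist x a / dist x a)) = 0"
      by simp
  qed simp
  then show ?thesis
    using assms(3) by simp
qed

text \<open>A ball of radius \<open>r\<close> about \<open>y\<close> inside \<open>A\<close> keeps
  the frontier at distance at least \<open>r\<close> from \<open>y\<close>, so the triangle
  inequality bounds all ratios uniformly.\<close>

lemma delta_less_infinity:
  fixes A :: "(real ^ 'n) set"
  assumes "open A" "x \<in> A" "y \<in> A"
  shows "delta A x y < \<infinity>"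
proof -
  obtain r where r: "0 < r" "ball y r \<subseteq> A"
    using assms openE by blast
  have "delta A x y \<le> ereal (ln (dist x y / r + 1))"
    unfolding delta_def
  proof (rule SUP_least)
    fix a assume a: "a \<in> frontier A"
    have "a \<notin> ball y r"
      using a r(2) assms(1) by (auto simp: frontier_open_eq)
    then have ra: "r \<le> dist y a"
      by simp
    have "dist x a / dist y a \<le> (dist x y + dist y a) / dist y a"
      by (intro divide_right_mono dist_triangle zero_le_dist)
    also have "\<dots> = dist x y / dist y a + 1"
      using ra r(1) by (auto simp: add_divide_distrib)
    also have "\<dots> \<le> dist x y / r + 1"
      using ra r(1) by (intro add_right_mono divide_left_mono mult_pos_pos) auto
    finally have "dist x a / dist y a \<le> dist x y / r + 1" .
    moreover have "0 < dist x a / dist y a"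
      using a assms by (intro divide_pos_pos dist_frontier_pos)
    ultimately show "ereal (ln (dist x a / dist y a)) \<le> ereal (ln (dist x y / r + 1))"
      by (simp add: ln_mono)
  qed
  then show ?thesis
    by (rule le_less_trans) simp
qed

lemma delta_nonneg_bounded:
  fixes A :: "(real ^ 'n) set"
  assumes "open A" "bounded A" "x \<in> A" "y \<in> A" "x \<noteq> y"
  shows "0 \<le> delta A x y"
proof -
  have "y \<in> interior A" "y - x \<noteq> 0"
    using assms by (auto simp: interior_open)
  then obtain t where t: "0 < t" "y + t *\<^sub>R (y - x) \<in> frontier A"
    by (rule ray_to_frontier[OF assms(2)])
  define a where "a = y + t *\<^sub>R (y - x)"
  \<comment> \<open>The points \<open>x\<close>, \<open>y\<close>, \<open>a\<close> are collinear
    with \<open>y\<close> between the other two, so both distances are explicit multiples of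
    \<open>norm (y - x)\<close>.\<close>
  have "x - a = (- (1 + t)) *\<^sub>R (y - x)"
    by (simp add: a_def algebra_simps)
  then have "dist x a = (1 + t) * norm (y - x)"
    using t(1) by (simp add: dist_norm)
  moreover have "dist y a = t * norm (y - x)"
    using t(1) by (simp add: a_def dist_norm)
  ultimately have "dist y a \<le> dist x a"
    by (simp add: algebra_simps)
  moreover have a: "a \<in> frontier A"
    using t(2) by (simp add: a_def)
  moreover have "0 < dist y a"
    using assms a dist_frontier_pos by blast
  ultimately have "0 \<le> ln (dist x a / dist y a)"
    by (intro ln_ge_zero) simp
  then show ?thesis
    using ln_ratio_le_delta[OF a, of x y] by (meson ereal_less_eq(5) order_trans)
qed

text \<open>The limit argument in contrapositive form: a negative supremum would hold all ratios
  below a constant \<open>c < 1\<close>, and that confines the frontier to a ball about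
  \<open>y\<close>.\<close>

lemma delta_nonneg_unbounded:
  fixes A :: "(real ^ 'n) set"
  assumes "open A" "\<not> bounded (frontier A)" "x \<in> A" "y \<in> A"
  shows "0 \<le> delta A x y"
proof (rule ccontr)
  assume "\<not> 0 \<le> delta A x y"
  \<comment> \<open>A real number strictly in between exists even if the supremum is
    \<open>-\<infinity>\<close>.\<close>
  then obtain s where s: "delta A x y < ereal s" "s < 0"
    using ereal_dense2[of "delta A x y" 0] by (auto simp: not_le)
  define c where "c = exp s"
  have c: "c < 1"
    using s(2) by (simp add: c_def)
  have "dist y a \<le> dist y x / (1 - c)" if a: "a \<in> frontier A" for a
  proof -
    have pos: "0 < dist x a" "0 < dist y a"
      using a assms dist_frontier_pos by blast+
    have "ereal (ln (dist x a / dist y a)) < ereal s"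
      using ln_ratio_le_delta[OF a] s(1) by (rule le_less_trans)
    then have "exp (ln (dist x a / dist y a)) < c"
      by (simp only: c_def exp_less_cancel_iff ereal_less_eq less_ereal.simps)
    then have "dist x a / dist y a < c"
      using pos by simp
    then have "dist x a < c * dist y a"
      using pos by (simp add: field_simps)
    \<comment> \<open>Here \<open>dist y a \<le> dist y x + dist x a\<close>, and the last term is
      less than \<open>c * dist y a\<close>.\<close>
    then have "(1 - c) * dist y a \<le> dist y x"
      using dist_triangle[of y a x] by (simp add: algebra_simps)
    then show ?thesis
      using c by (simp add: field_simps)
  qed
  then have "bounded (frontier A)"
    unfolding bounded_def by blast
  with assms(2) show False ..
qed

text \<open>For a fixed frontier point the log ratios add exactly; each summand is then bounded by
  its own supremum.\<close>

lemma delta_triangle: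
  fixes A :: "(real ^ 'n) set"
  assumes "open A" "x \<in> A" "y \<in> A" "z \<in> A"
  shows "delta A x z \<le> delta A x y + delta A y z"
  unfolding delta_def[of A x z]
proof (rule SUP_least)
  fix a assume a: "a \<in> frontier A"
  have "0 < dist x a" "0 < dist y a" "0 < dist z a"
    using a assms dist_frontier_pos by blast+
  then have "ln (dist x a / dist z a) = ln (dist x a / dist y a) + ln (dist y a / dist z a)"
    by (simp add: ln_div)
  then have "ereal (ln (dist x a / dist z a)) =
      ereal (ln (dist x a / dist y a)) + ereal (ln (dist y a / dist z a))"
    by simp
  also have "\<dots> \<le> delta A x y + delta A y z"
    using a by (intro add_mono ln_ratio_le_delta)
  finally show "ereal (ln (dist x a / dist z a)) \<le> delta A x y + delta A y z" .
qed

theorem proposition4p1: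
  fixes A :: "(real ^ 'n) set"
  assumes "open A"
    and "bounded A \<or> \<not> bounded (frontier A)"
  shows "weak_metric_on A (delta A)"
proof -
  have self: "delta A x x = 0" if "x \<in> A" for x
    using delta_self[OF assms(1) that frontier_nonempty[OF assms(2) that]] .
  have nonneg: "0 \<le> delta A x y" if xy: "x \<in> A" "y \<in> A" for x y
    using assms(2)
  proof
    assume "bounded A"
    then show ?thesis
      \<comment> \<open>For \<open>x = y\<close> there is no ray direction, so this case falls back
        on the vanishing diagonal.\<close>
      using delta_nonneg_bounded[OF assms(1) _ xy] self[OF xy(1)] by (cases "x = y") auto
  next
    assume "\<not> bounded (frontier A)"
    then show ?thesis
      by (rule delta_nonneg_unbounded[OF assms(1) _ xy])
  qed
  show ?thesis
    unfolding weak_metric_on_def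
    by (intro conjI ballI self nonneg delta_less_infinity delta_triangle assms(1))
qed

end
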